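(* Let $(\mathbb{R}^{3},g_{Sol})$ denote Sol space, where the metric with respect to the standard coordinates $(x,y,z)$ in $\mathbb{R}^{3}$ is $g_{Sol}=e^{2z}{\rm d}x^{2}+e^{-2z}{\rm d}y^{2}+{\rm d}z^{2}$. A linear map $\varphi:\mathbb{R}^{m}\to(\mathbb{R}^{3},g_{Sol})$ from Euclidean space (with its standard metric) is $\infty$-harmonic if and only if it is a composition of a linear map $\mathbb{R}^{m}\to\mathbb{R}^{2}$ followed by the inclusion map $i_{1}:\mathbb{R}^{2}\to\mathbb{R}^{3}$, $i_{1}(x,y)=(x,y,0)$, or $\varphi$ is a composition of a linear map $\mathbb{R}^{m}\to\mathbb{R}$ followed by the inclusion map $i_{2}:\mathbb{R}\to\mathbb{R}^{3}$, $i_{2}(z)=(0,0,z)$.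
   Context: A smooth map $\varphi:(M,g)\to(N,h)$ between Riemannian manifolds is called $\infty$-harmonic if $\tfrac12\,{\rm d}\varphi({\rm grad}\,|{\rm d}\varphi|^2)=0$ on $M$, where $|{\rm d}\varphi|^2={\rm Trace}_g\,\varphi^*h$ is the energy density of $\varphi$ and the gradient is taken with respect to $g$. *)

theory Defs
  imports "HOL-Analysis.Analysis"
begin

text \<open>
  All manifolds here have underlying space \<open>real ^ 'n\<close> with its standard global chart, so each
  tangent space is identified with \<open>real ^ 'n\<close>, a (0,2)-tensor field \<open>g\<close> is a function taking
  a point and two tangent vectors, and the differential of a map at \<open>p\<close> is its Frechet derivative
  at \<open>p\<close>.
\<close>

primrec Ck :: "nat \<Rightarrow> ('a::real_normed_vector \<Rightarrow> 'b::real_normed_vector) \<Rightarrow> bool" where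
  "Ck 0 f \<longleftrightarrow> continuous_on UNIV f"
| "Ck (Suc k) f \<longleftrightarrow> (\<forall>p. f differentiable at p) \<and> (\<forall>v. Ck k (\<lambda>p. frechet_derivative f (at p) v))"

definition smooth_map :: "('a::real_normed_vector \<Rightarrow> 'b::real_normed_vector) \<Rightarrow> bool" where
  "smooth_map f \<longleftrightarrow> (\<forall>k. Ck k f)"

type_synonym 'n tensor02 = "real ^ 'n \<Rightarrow> real ^ 'n \<Rightarrow> real ^ 'n \<Rightarrow> real"

definition riemannian_metric :: "'n::finite tensor02 \<Rightarrow> bool" where
  "riemannian_metric g \<longleftrightarrow>
     (\<forall>p. bilinear (g p) \<and> (\<forall>u v. g p u v = g p v u) \<and> (\<forall>v. v \<noteq> 0 \<longrightarrow> 0 < g p v v)) \<and>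
     (\<forall>u v. smooth_map (\<lambda>p. g p u v))"

definition pullback :: "(real ^ 'm \<Rightarrow> real ^ 'n) \<Rightarrow> 'n tensor02 \<Rightarrow> 'm::finite tensor02" where
  "pullback \<phi> h p u v =
     h (\<phi> p) (frechet_derivative \<phi> (at p) u) (frechet_derivative \<phi> (at p) v)"

definition components :: "(real ^ 'n \<Rightarrow> real ^ 'n \<Rightarrow> real) \<Rightarrow> real ^ 'n ^ 'n::finite" where
  "components b = (\<chi> i j. b (axis i 1) (axis j 1))"

text \<open>The contraction \<open>\<Sum>i j. g\<^sup>i\<^sup>j b\<^sub>i\<^sub>j\<close>, where \<open>g\<^sup>i\<^sup>j\<close> are the components of the inverse metric.\<close>

definition metric_trace :: "'n::finite tensor02 \<Rightarrow> 'n tensor02 \<Rightarrow> real ^ 'n \<Rightarrow> real" where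
  "metric_trace g b p = trace (matrix_inv (components (g p)) ** components (b p))"

definition energy_density ::
  "'m::finite tensor02 \<Rightarrow> 'n::finite tensor02 \<Rightarrow> (real ^ 'm \<Rightarrow> real ^ 'n) \<Rightarrow> real ^ 'm \<Rightarrow> real" where
  "energy_density g h \<phi> = metric_trace g (pullback \<phi> h)"

text \<open>The unique vector exists because a Riemannian metric is nondegenerate at each point.\<close>

definition grad :: "'n::finite tensor02 \<Rightarrow> (real ^ 'n \<Rightarrow> real) \<Rightarrow> real ^ 'n \<Rightarrow> real ^ 'n" where
  "grad g f p = (THE w. \<forall>v. g p w v = frechet_derivative f (at p) v)"

definition infinity_harmonic ::
  "'m::finite tensor02 \<Rightarrow> 'n::finite tensor02 \<Rightarrow> (real ^ 'm \<Rightarrow> real ^ 'n) \<Rightarrow> bool" where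
  "infinity_harmonic g h \<phi> \<longleftrightarrow>
     riemannian_metric g \<and> riemannian_metric h \<and> smooth_map \<phi> \<and>
     (\<forall>p. (1/2) *\<^sub>R frechet_derivative \<phi> (at p) (grad g (energy_density g h \<phi>) p) = 0)"

definition flat_metric :: "'n::finite tensor02" where
  "flat_metric p u v = u \<bullet> v"

definition sol_metric :: "3 tensor02" where
  "sol_metric p u v =
     exp (2 * p $ 3) * (u $ 1 * v $ 1) + exp (- 2 * p $ 3) * (u $ 2 * v $ 2) + u $ 3 * v $ 3"

definition incl_xy :: "real ^ 2 \<Rightarrow> real ^ 3" where
  "incl_xy w = vector [w $ 1, w $ 2, 0]"

definition incl_z :: "real \<Rightarrow> real ^ 3" where
  "incl_z z = vector [0, 0, z]"

lemma smooth_map_const: "smooth_map (\<lambda>_. c)"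
proof -
  have "Ck k (\<lambda>_::'a. c)" for k and c :: 'b
    by (induction k arbitrary: c) (simp_all add: frechet_derivative_const)
  then show ?thesis by (simp add: smooth_map_def)
qed

lemma riemannian_metric_flat: "riemannian_metric flat_metric"
proof -
  have "bilinear (flat_metric p)" for p :: "real ^ 'n"
    unfolding bilinear_def flat_metric_def
    by (auto intro!: linearI simp: inner_add_left inner_add_right)
  then show ?thesis
    unfolding riemannian_metric_def
    by (auto simp: flat_metric_def inner_commute smooth_map_const)
qed

lemma riemannian_metric_sol: "riemannian_metric sol_metric"
proof -
  have Ck: "Ck k (\<lambda>p::real^3. exp (2 * p $ 3) * a + exp (- 2 * p $ 3) * b + c)" for k a b c
  proof (induction k arbitrary: a b c)
    case 0
    show ?case by (auto intro!: continuous_intros)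
  next
    case (Suc k)
    let ?f = "\<lambda>p::real^3. exp (2 * p $ 3) * a + exp (- 2 * p $ 3) * b + c"
    let ?D = "\<lambda>p v::real^3. exp (2 * p $ 3) * (2 * v $ 3 * a) + exp (- 2 * p $ 3) * (- 2 * v $ 3 * b) + 0"
    have D: "(?f has_derivative ?D p) (at p)" for p
      by (auto intro!: derivative_eq_intros bounded_linear.has_derivative[OF bounded_linear_vec_nth] simp: fun_eq_iff algebra_simps)
    have "frechet_derivative ?f (at p) = ?D p" for p
      by (rule frechet_derivative_at[OF D, symmetric])
    moreover have "?f differentiable at p" for p
      using D by (rule differentiableI)
    ultimately show ?case
      by (simp only: Ck.simps Suc.IH simp_thms)
  qed
  have "bilinear (sol_metric p)" for p
    unfolding bilinear_def sol_metric_def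
    by (auto intro!: linearI simp: algebra_simps)
  moreover have "0 < sol_metric p v v" if "v \<noteq> 0" for p v
  proof -
    have "v $ 1 \<noteq> 0 \<or> v $ 2 \<noteq> 0 \<or> v $ 3 \<noteq> 0"
      using that by (auto simp: vec_eq_iff forall_3)
    then have "0 < v $ 1 * v $ 1 \<or> 0 < v $ 2 * v $ 2 \<or> 0 < v $ 3 * v $ 3"
      by (simp add: zero_less_mult_iff linorder_neq_iff) argo
    moreover have "0 \<le> v $ 1 * v $ 1" "0 \<le> v $ 2 * v $ 2" "0 \<le> v $ 3 * v $ 3"
      by simp_all
    ultimately show ?thesis
      unfolding sol_metric_def
      by (smt (verit) exp_gt_zero mult_pos_pos mult_nonneg_nonneg)
  qed
  ultimately show ?thesis
    using Ck unfolding riemannian_metric_def smooth_map_def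
    by (auto simp: sol_metric_def mult.commute)
qed

end

(*
For linear \<phi> with rows a, b, c the energy density is |a|^2 e^{2z} + |b|^2 e^{-2z} + |c|^2 with
z = c \<bullet> p, whose Euclidean gradient is 2 (|a|^2 e^{2z} - |b|^2 e^{-2z}) c. The third component of
its image under \<phi> carries the factor |c|^2, so \<infinity>-harmonicity forces c = 0, or else
|a|^2 e^{2z} = |b|^2 e^{-2z} for every real z, that is a = b = 0.
*)
theory Submission
  imports Defs
begin

text \<open>The derivative of \<open>f\<close> is \<open>f\<close> itself at every point, so each
  directional derivative is a constant function of \<open>p\<close> and
  \<open>smooth_map_const\<close> settles all higher orders without an induction.\<close>

lemma smooth_map_bounded_linear:
  assumes "bounded_linear f"
  shows "smooth_map f"
proof -
  have "Ck k f" for k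
  proof (cases k)
    case 0
    then show ?thesis
      using assms by (simp add: linear_continuous_on)
  next
    case (Suc n)
    have "frechet_derivative f (at p) = f" for p
      by (rule frechet_derivative_at[OF bounded_linear_imp_has_derivative[OF assms], symmetric])
    then show ?thesis
      using Suc assms
      by (simp add: bounded_linear_imp_differentiable smooth_map_const[unfolded smooth_map_def])
  qed
  then show ?thesis
    by (simp add: smooth_map_def)
qed

text \<open>The standard basis is orthonormal, so the matrix to be inverted is the identity.\<close>

lemma metric_trace_flat:
  "metric_trace flat_metric b p = (\<Sum>i\<in>UNIV. b p (axis i 1) (axis i 1))"
proof -
  have "components (flat_metric p :: real ^ 'a \<Rightarrow> _) = mat 1"
    by (simp add: components_def flat_metric_def mat_def vec_eq_iff inner_axis_axis)
  moreover have "matrix_inv (mat 1 :: real ^ 'a ^ 'a) = mat 1"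
    by (simp add: matrix_inv_def)
  ultimately show ?thesis
    by (simp add: metric_trace_def trace_def components_def)
qed

text \<open>Lets a gradient be read off from a derivative. The definite description in
  \<open>grad\<close> is resolved because a vector is determined by its inner products with all
  vectors.\<close>

lemma grad_flat:
  assumes "(f has_derivative (\<lambda>v. w \<bullet> v)) (at p)"
  shows "grad flat_metric f p = w"
proof -
  have "frechet_derivative f (at p) = (\<lambda>v. w \<bullet> v)"
    by (rule frechet_derivative_at[OF assms, symmetric])
  then show ?thesis
    unfolding grad_def flat_metric_def
    by (auto intro!: the_equality simp: vector_eq_rdot)
qed

lemma linear_component:
  fixes \<phi> :: "real ^ 'm \<Rightarrow> real ^ 'n"
  assumes "linear \<phi>"
  shows "\<phi> p $ k = matrix \<phi> $ k \<bullet> p"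
  using matrix_vector_mul(2)[OF assms, THEN fun_cong, of p] matrix_vector_mul_component[of "matrix \<phi>" p k] by simp

text \<open>Summing the squares of the entries in row \<open>k\<close> over the basis vectors gives
  the squared norm of that row. The exponential weights are taken at the image point, whose third
  coordinate is \<open>A $ 3 \<bullet> p\<close>.\<close>

lemma energy_density_sol:
  fixes \<phi> :: "real ^ 'm \<Rightarrow> real ^ 3"
  assumes "linear \<phi>"
  defines "A \<equiv> matrix \<phi>"
  shows "energy_density flat_metric sol_metric \<phi> p =
    exp (2 * (A $ 3 \<bullet> p)) * (A $ 1 \<bullet> A $ 1) + exp (- 2 * (A $ 3 \<bullet> p)) * (A $ 2 \<bullet> A $ 2)
      + A $ 3 \<bullet> A $ 3"
proof -
  have "bounded_linear \<phi>"
    using assms(1) by (simp add: linear_conv_bounded_linear)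
  then have "frechet_derivative \<phi> (at p) = \<phi>"
    by (intro frechet_derivative_at[symmetric] bounded_linear_imp_has_derivative)
  moreover have "v \<bullet> v = (\<Sum>i\<in>UNIV. v $ i * v $ i)" for v :: "real ^ 'm"
    by (simp add: inner_vec_def)
  ultimately show ?thesis
    unfolding energy_density_def metric_trace_flat pullback_def sol_metric_def A_def
    by (simp add: linear_component[OF assms(1)] inner_axis sum.distrib sum_distrib_left)
qed

text \<open>The density varies with \<open>p\<close> only through \<open>A $ 3 \<bullet> p\<close>,
  so by the chain rule its gradient is a multiple of the row \<open>A $ 3\<close>.\<close>

lemma grad_energy_density_sol:
  fixes \<phi> :: "real ^ 'm \<Rightarrow> real ^ 3"
  assumes "linear \<phi>"
  defines "A \<equiv> matrix \<phi>"
  shows "grad flat_metric (energy_density flat_metric sol_metric \<phi>) p =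
    (2 * exp (2 * (A $ 3 \<bullet> p)) * (A $ 1 \<bullet> A $ 1) - 2 * exp (- 2 * (A $ 3 \<bullet> p)) * (A $ 2 \<bullet> A $ 2))
      *\<^sub>R A $ 3"
proof (rule grad_flat)
  show "(energy_density flat_metric sol_metric \<phi> has_derivative
    (\<lambda>v. (2 * exp (2 * (A $ 3 \<bullet> p)) * (A $ 1 \<bullet> A $ 1)
      - 2 * exp (- 2 * (A $ 3 \<bullet> p)) * (A $ 2 \<bullet> A $ 2)) *\<^sub>R A $ 3 \<bullet> v)) (at p)"
    unfolding energy_density_sol[OF assms(1), folded A_def, abs_def]
    by (auto intro!: derivative_eq_intros simp: fun_eq_iff algebra_simps)
qed

lemma infinity_harmonic_sol_iff:
  fixes \<phi> :: "real ^ 'm \<Rightarrow> real ^ 3"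
  assumes "linear \<phi>"
  defines "A \<equiv> matrix \<phi>"
  shows "infinity_harmonic flat_metric sol_metric \<phi> \<longleftrightarrow> A $ 3 = 0 \<or> A $ 1 = 0 \<and> A $ 2 = 0"
proof
  have bl: "bounded_linear \<phi>"
    using assms(1) by (simp add: linear_conv_bounded_linear)
  have fd: "frechet_derivative \<phi> (at p) = \<phi>" for p
    by (intro frechet_derivative_at[symmetric] bounded_linear_imp_has_derivative bl)
  let ?G = "\<lambda>p. grad flat_metric (energy_density flat_metric sol_metric \<phi>) p"
  note G = grad_energy_density_sol[OF assms(1), folded A_def]
  show "infinity_harmonic flat_metric sol_metric \<phi>" if "A $ 3 = 0 \<or> A $ 1 = 0 \<and> A $ 2 = 0"
  proof -
    have "?G p = 0" for p
      using that unfolding G by auto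
    then show ?thesis
      by (simp add: infinity_harmonic_def riemannian_metric_flat riemannian_metric_sol
          smooth_map_bounded_linear bl fd linear_0[OF assms(1)])
  qed
  show "A $ 3 = 0 \<or> A $ 1 = 0 \<and> A $ 2 = 0" if "infinity_harmonic flat_metric sol_metric \<phi>"
  proof (cases "A $ 3 = 0")
    case c: False
    have bal: "exp (2 * t) * (A $ 1 \<bullet> A $ 1) = exp (- 2 * t) * (A $ 2 \<bullet> A $ 2)" for t
    proof -
      \<comment> \<open>This point on the line spanned by \<open>A $ 3\<close> makes the height of
        the image equal to \<open>t\<close>. Since the row is nonzero, every real height is
        attained.\<close>
      define p where "p = (t / (A $ 3 \<bullet> A $ 3)) *\<^sub>R A $ 3"
      have t: "A $ 3 \<bullet> p = t"
        using c by (simp add: p_def)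
      have "\<phi> (?G p) $ 3 = 0"
        using that by (simp add: infinity_harmonic_def fd)
      \<comment> \<open>The left side is the coefficient of the gradient times the squared norm of
        \<open>A $ 3\<close>; cancelling that nonzero norm leaves the balance of the two
        exponentials.\<close>
      then have "A $ 3 \<bullet> ?G p = 0"
        by (simp add: linear_component[OF assms(1)] A_def)
      then show ?thesis
        using c unfolding G t by simp
    qed
    \<comment> \<open>Height 0 makes the two squared norms equal; height 1, where the weights
      differ, then forces their common value to be zero.\<close>
    have eq: "A $ 1 \<bullet> A $ 1 = A $ 2 \<bullet> A $ 2"
      using bal[of 0] by simp
    have "exp 2 \<noteq> exp (- 2 :: real)"
      by simp
    then have "A $ 1 \<bullet> A $ 1 = 0"
      using bal[of 1] eq by simp
    then show ?thesis
      using eq by simp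
  qed simp
qed

lemma factors_through_incl_xy_iff:
  fixes \<phi> :: "real ^ 'm \<Rightarrow> real ^ 3"
  assumes "linear \<phi>"
  shows "(\<exists>B. linear B \<and> \<phi> = incl_xy \<circ> B) \<longleftrightarrow> (\<forall>p. \<phi> p $ 3 = 0)"
proof
  assume z: "\<forall>p. \<phi> p $ 3 = 0"
  \<comment> \<open>Dropping the coordinate that vanishes leaves the required linear factor.\<close>
  let ?B = "\<lambda>p. vector [\<phi> p $ 1, \<phi> p $ 2] :: real ^ 2"
  have "linear ?B"
    by (rule linearI)
      (simp_all add: vec_eq_iff forall_2 linear_add[OF assms] linear_cmul[OF assms])
  moreover have "\<phi> = incl_xy \<circ> ?B"
    using z by (simp add: fun_eq_iff vec_eq_iff forall_3 incl_xy_def)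
  ultimately show "\<exists>B. linear B \<and> \<phi> = incl_xy \<circ> B"
    by blast
qed (auto simp: incl_xy_def)

lemma factors_through_incl_z_iff:
  fixes \<phi> :: "real ^ 'm \<Rightarrow> real ^ 3"
  assumes "linear \<phi>"
  shows "(\<exists>B. linear B \<and> \<phi> = incl_z \<circ> B) \<longleftrightarrow> (\<forall>p. \<phi> p $ 1 = 0 \<and> \<phi> p $ 2 = 0)"
proof
  assume z: "\<forall>p. \<phi> p $ 1 = 0 \<and> \<phi> p $ 2 = 0"
  let ?B = "\<lambda>p. \<phi> p $ 3"
  have "linear ?B"
    by (rule linearI) (simp_all add: linear_add[OF assms] linear_cmul[OF assms])
  moreover have "\<phi> = incl_z \<circ> ?B"
    using z by (simp add: fun_eq_iff vec_eq_iff forall_3 incl_z_def)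
  ultimately show "\<exists>B. linear B \<and> \<phi> = incl_z \<circ> B"
    by blast
qed (auto simp: incl_z_def)

theorem theorem6p2:
  fixes \<phi> :: "real ^ 'm \<Rightarrow> real ^ 3"
  assumes "linear \<phi>"
  shows "infinity_harmonic flat_metric sol_metric \<phi> \<longleftrightarrow>
    (\<exists>A :: real ^ 'm \<Rightarrow> real ^ 2. linear A \<and> \<phi> = incl_xy \<circ> A) \<or>
    (\<exists>A :: real ^ 'm \<Rightarrow> real. linear A \<and> \<phi> = incl_z \<circ> A)"
proof -
  \<comment> \<open>Taking \<open>p\<close> to be the row itself yields its squared norm, so a
    component that vanishes everywhere has a zero row. This matches the row conditions with the two
    factorisations.\<close>
  have "(\<forall>p. \<phi> p $ k = 0) \<longleftrightarrow> matrix \<phi> $ k = 0" for k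
    using linear_component[OF assms, of _ k] by (metis inner_eq_zero_iff inner_zero_left)
  then show ?thesis
    unfolding infinity_harmonic_sol_iff[OF assms] factors_through_incl_xy_iff[OF assms]
      factors_through_incl_z_iff[OF assms]
    by (simp add: all_conj_distrib)
qed

end
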